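(* The matrices $\widehat\Xi^i$ $(i=1,2,3)$ are expressed in terms of $\widehat C$ and their eigenvectors with non-zero eigenvalue as $$\widehat\Xi^1=-(\lambda_1+\lambda_3)\,\widehat C\,({}^te_2,{}^te_5)\,(\widehat C_1)^{-1}\begin{pmatrix} e_2 \\ e_5 \end{pmatrix},$$ $$\widehat\Xi^2=-(\lambda_2+\lambda_3)\,\widehat C\,({}^te_3,{}^te_5)\,(\widehat C_2)^{-1}\begin{pmatrix} e_3 \\ e_5 \end{pmatrix},$$ $$\widehat\Xi^3=2(\lambda_3+\lambda_4)\,\widehat C\,{}^te_4\,(\widehat C_{44})^{-1}\,e_4.$$
   Context: $\lambda_1,\dots,\lambda_4$ are indeterminates over $\mathbb C$, and $\lambda_0=-(\lambda_1+\lambda_2+2\lambda_3+\lambda_4)$, $\lambda_{123}=\lambda_1+\lambda_2+\lambda_3$, $\lambda_{134}^-=-(\lambda_1+\lambda_3+\lambda_4)$, $\lambda_{234}^-=-(\lambda_2+\lambda_3+\lambda_4)$. All matrices have entries in $\mathbb C(\lambda_1,\dots,\lambda_4)$. The matrices $\widehat\Xi^i$ (coefficient matrices of logarithmic $1$-forms in the pull-back of the connection of Appell's system $F_4$ under a double cover) are $$\widehat\Xi^1=\begin{pmatrix} 0&-\lambda_4&0&0\\ 0&-\lambda_1-\lambda_3&0&0\\ \frac{-\lambda_{123}}{2}&\frac{-\lambda_2+\lambda_4}{2}&\frac{-\lambda_1+\lambda_4}{2}&\frac{-\lambda_3}{2}\\ \frac{(\lambda_{134}^--\lambda_3)\lambda_{123}}{2\lambda_3}&\lambda_4+\frac{(\lambda_2+\lambda_4)(\lambda_1+\lambda_4)}{2\lambda_3}&\frac{(\lambda_1-\lambda_4)(\lambda_{134}^--\lambda_3)}{2\lambda_3}&\frac{\lambda_{134}^--\lambda_3}{2}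 \end{pmatrix},$$ $$\widehat\Xi^2=\begin{pmatrix} 0&0&-\lambda_4&0\\ \frac{-\lambda_{123}}{2}&\frac{-\lambda_2+\lambda_4}{2}&\frac{-\lambda_1+\lambda_4}{2}&\frac{-\lambda_3}{2}\\ 0&0&-\lambda_3-\lambda_2&0\\ \frac{(\lambda_{234}^--\lambda_3)\lambda_{123}}{2\lambda_3}&\frac{(\lambda_2-\lambda_4)(\lambda_{234}^--\lambda_3)}{2\lambda_3}&\lambda_4+\frac{(\lambda_2+\lambda_4)(\lambda_1+\lambda_4)}{2\lambda_3}&\frac{\lambda_{234}^--\lambda_3}{2} \end{pmatrix},$$ $\widehat\Xi^3=\mathrm{diag}(0,0,0,2(\lambda_3+\lambda_4))$. The symmetric $4\times4$ matrix $\widehat C=(\widehat C_{ij})$ (the matrix of intersection numbers of the frame $\widehat\varphi_1,\dots,\widehat\varphi_4$ divided by $(2\pi\sqrt{-1})^2$) has entries $$\widehat C_{11}=\frac1{\lambda_{123}}\Bigl(\frac1{\lambda_1}+\frac1{\lambda_2}\Bigr)+\frac1{\lambda_{134}^-}\Bigl(\frac1{\lambda_0}+\frac1{\lambda_2}\Bigr)+\frac1{\lambda_{234}^-}\Bigl(\frac1{\lambda_0}+\frac1{\lambda_1}\Bigr),$$ $$\widehat C_{12}=\frac{-1}{\lambda_{134}^-}\Bigl(\frac1{\lambda_0}+\frac1{\lambda_2}\Bigr),\quad \widehat C_{13}=\frac{-1}{\lambda_{234}^-}\Bigl(\frac1{\lambda_0}+\frac1{\lambda_1}\Bigr),\quad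 \widehat C_{22}=\Bigl(\frac1{\lambda_0}+\frac1{\lambda_2}\Bigr)\Bigl(\frac1{\lambda_4}+\frac1{\lambda_{134}^-}\Bigr),$$ $$\widehat C_{23}=\frac{-1}{\lambda_0\lambda_4},\quad \widehat C_{33}=\Bigl(\frac1{\lambda_0}+\frac1{\lambda_1}\Bigr)\Bigl(\frac1{\lambda_4}+\frac1{\lambda_{234}^-}\Bigr),\quad \widehat C_{44}=\frac2{\lambda_3\lambda_4},\quad \widehat C_{14}=\widehat C_{24}=\widehat C_{34}=0.$$ The row vectors are $e_2=(0,1,0,0)$, $e_3=(0,0,1,0)$, $e_4=(0,0,0,1)$, $e_5=\left(\frac{\lambda_{123}}{\lambda_3},\frac{\lambda_2-\lambda_4}{\lambda_3},\frac{\lambda_1-\lambda_4}{\lambda_3},1\right)$; they span the left eigenspaces with non-zero eigenvalue ($e_2,e_5$ for $\widehat\Xi^1$; $e_3,e_5$ for $\widehat\Xi^2$; $e_4$ for $\widehat\Xi^3$). The $2\times2$ matrices of (normalized) intersection numbers are $$\widehat C_1=\begin{pmatrix} e_2 \\ e_5 \end{pmatrix}\widehat C({}^te_2,{}^te_5)=\begin{pmatrix}\frac{(\lambda_3-\lambda_{134}^-)(\lambda_1+\lambda_3)}{\lambda_0\lambda_2\lambda_4\lambda_{134}^-}&\frac{-2(\lambda_1+\lambda_3)}{\lambda_0\lambda_3\lambda_4}\\ \frac{-2(\lambda_1+\lambda_3)}{\lambda_0\lambda_3\lambda_4}&\frac{-4(\lambda_2+\lambda_3)(\lambda_1+\lambda_3)}{\lambda_0\lambda_3^2\lambda_4}\end{pmatrix},$$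 $$\widehat C_2=\begin{pmatrix} e_3 \\ e_5 \end{pmatrix}\widehat C({}^te_3,{}^te_5)=\begin{pmatrix}\frac{(\lambda_3-\lambda_{234}^-)(\lambda_2+\lambda_3)}{\lambda_0\lambda_1\lambda_4\lambda_{234}^-}&\frac{-2(\lambda_2+\lambda_3)}{\lambda_0\lambda_3\lambda_4}\\ \frac{-2(\lambda_2+\lambda_3)}{\lambda_0\lambda_3\lambda_4}&\frac{-4(\lambda_2+\lambda_3)(\lambda_1+\lambda_3)}{\lambda_0\lambda_3^2\lambda_4}\end{pmatrix}.$$ *)

theory Defs
  imports
    "HOL-Analysis.Analysis"
    "HOL-Computational_Algebra.Polynomial_Factorial"
begin

text \<open>
  The field of rational functions in four indeterminates over the complex numbers, as the
  fraction field of the iterated polynomial ring. The indeterminate of the innermost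
  polynomial ring is \<open>l1\<close>, that of the outermost one is \<open>l4\<close>.
\<close>

type_synonym ratfun4 = "complex poly poly poly poly fract"

definition l1 :: ratfun4 where "l1 = to_fract [:[:[:[:0, 1:]:]:]:]"
definition l2 :: ratfun4 where "l2 = to_fract [:[:[:0, 1:]:]:]"
definition l3 :: ratfun4 where "l3 = to_fract [:[:0, 1:]:]"
definition l4 :: ratfun4 where "l4 = to_fract [:0, 1:]"

definition l0 :: ratfun4 where "l0 = - (l1 + l2 + 2 * l3 + l4)"
definition l123 :: ratfun4 where "l123 = l1 + l2 + l3"
definition l134m :: ratfun4 where "l134m = - (l1 + l3 + l4)"
definition l234m :: ratfun4 where "l234m = - (l2 + l3 + l4)"

text \<open>
  Matrices are given by their lists of rows. In the index type \<open>4\<close> the numeral \<open>4\<close> equals \<open>0\<close>,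
  so the following is what makes \<open>vector\<close> list the components in the order 1, 2, 3, 4.
\<close>

lemma vector_4_nth:
  fixes a b c d :: "'a::zero"
  shows "(vector [a, b, c, d] :: 'a^4) $ 1 = a"
    and "(vector [a, b, c, d] :: 'a^4) $ 2 = b"
    and "(vector [a, b, c, d] :: 'a^4) $ 3 = c"
    and "(vector [a, b, c, d] :: 'a^4) $ 4 = d"
  unfolding vector_def by simp_all

definition mat_scale :: "'a::times \<Rightarrow> 'a^'n^'m \<Rightarrow> 'a^'n^'m" (infixr \<open>*\<^sub>M\<close> 65)
  where "c *\<^sub>M A = (\<chi> i j. c * A $ i $ j)"

definition left_eigenspace :: "'a::semiring_1^'n^'n \<Rightarrow> 'a \<Rightarrow> ('a^'n) set"
  where "left_eigenspace A c = {v. v v* A = c *s v}"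

definition hatXi1 :: "ratfun4^4^4" where
  "hatXi1 = vector [
    vector [0, - l4, 0, 0],
    vector [0, - l1 - l3, 0, 0],
    vector [- l123 / 2, (- l2 + l4) / 2, (- l1 + l4) / 2, - l3 / 2],
    vector [(l134m - l3) * l123 / (2 * l3),
            l4 + (l2 + l4) * (l1 + l4) / (2 * l3),
            (l1 - l4) * (l134m - l3) / (2 * l3),
            (l134m - l3) / 2]]"

definition hatXi2 :: "ratfun4^4^4" where
  "hatXi2 = vector [
    vector [0, 0, - l4, 0],
    vector [- l123 / 2, (- l2 + l4) / 2, (- l1 + l4) / 2, - l3 / 2],
    vector [0, 0, - l3 - l2, 0],
    vector [(l234m - l3) * l123 / (2 * l3),
            (l2 - l4) * (l234m - l3) / (2 * l3),
            l4 + (l2 + l4) * (l1 + l4) / (2 * l3),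
            (l234m - l3) / 2]]"

definition hatXi3 :: "ratfun4^4^4" where
  "hatXi3 = vector [
    vector [0, 0, 0, 0],
    vector [0, 0, 0, 0],
    vector [0, 0, 0, 0],
    vector [0, 0, 0, 2 * (l3 + l4)]]"

definition c11 :: ratfun4 where
  "c11 = 1 / l123 * (1 / l1 + 1 / l2) + 1 / l134m * (1 / l0 + 1 / l2)
       + 1 / l234m * (1 / l0 + 1 / l1)"
definition c12 :: ratfun4 where "c12 = - 1 / l134m * (1 / l0 + 1 / l2)"
definition c13 :: ratfun4 where "c13 = - 1 / l234m * (1 / l0 + 1 / l1)"
definition c22 :: ratfun4 where "c22 = (1 / l0 + 1 / l2) * (1 / l4 + 1 / l134m)"
definition c23 :: ratfun4 where "c23 = - 1 / (l0 * l4)"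
definition c33 :: ratfun4 where "c33 = (1 / l0 + 1 / l1) * (1 / l4 + 1 / l234m)"
definition c44 :: ratfun4 where "c44 = 2 / (l3 * l4)"

definition hatC :: "ratfun4^4^4" where
  "hatC = vector [
    vector [c11, c12, c13, 0],
    vector [c12, c22, c23, 0],
    vector [c13, c23, c33, 0],
    vector [0, 0, 0, c44]]"

definition e2 :: "ratfun4^4" where "e2 = vector [0, 1, 0, 0]"
definition e3 :: "ratfun4^4" where "e3 = vector [0, 0, 1, 0]"
definition e4 :: "ratfun4^4" where "e4 = vector [0, 0, 0, 1]"
definition e5 :: "ratfun4^4" where
  "e5 = vector [l123 / l3, (l2 - l4) / l3, (l1 - l4) / l3, 1]"

definition E25 :: "ratfun4^4^2" where "E25 = vector [e2, e5]"
definition E35 :: "ratfun4^4^2" where "E35 = vector [e3, e5]"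

definition hatC1 :: "ratfun4^2^2" where "hatC1 = E25 ** hatC ** transpose E25"
definition hatC2 :: "ratfun4^2^2" where "hatC2 = E35 ** hatC ** transpose E35"

end

theory Submission
  imports Defs
begin

text \<open>
  The first two matrices have rank two and act on the span of their two rows of eigenvectors as a
  scalar: writing \<open>E\<close> for the \<open>2 \<times> 4\<close> matrix of these eigenvectors, one has \<open>\<Xi> = P E\<close> for a
  \<open>4 \<times> 2\<close> matrix \<open>P\<close> of coordinates, and \<open>E P = \<mu>\<close>. This alone determines the left
  eigenspaces with non-zero eigenvalue (\<open>left_eigenspaces_of_product\<close>).

  The connection matrix is moreover self-adjoint for the intersection form \<open>C\<close>, that is,
  \<open>\<Xi> C = C \<Xi>\<^sup>T\<close>. Multiplying by \<open>E\<^sup>T\<close> on the right and using \<open>\<Xi>\<^sup>T E\<^sup>T = \<mu> E\<^sup>T\<close> gives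
  \<open>P (E C E\<^sup>T) = \<mu> C E\<^sup>T\<close>. Once the Gram matrix \<open>E C E\<^sup>T\<close> is known to be invertible, this can be
  solved for \<open>P\<close>, and \<open>\<Xi> = P E\<close> becomes the formula of the theorem
  (\<open>product_from_gram_matrix\<close>). So the projection formula comes down to one linear identity, which
  is verified here directly in the form \<open>P (E C E\<^sup>T) = \<mu> C E\<^sup>T\<close>, and one determinant.

  Both computations stay small because the eigenvector \<open>e5\<close>, shared by the first two matrices,
  has a simple image under \<open>C\<close> (\<open>hatC_e5\<close>): the sums of reciprocals in the first three rows of
  \<open>C\<close> collapse to multiples of the linear forms \<open>l4\<close>, \<open>l1 + l3\<close>, \<open>l2 + l3\<close>. The second matrix
  arises from the first by exchanging \<open>l1\<close> with \<open>l2\<close> and the second with the third coordinate,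
  so every computation occurs in two mirror forms. For the third matrix \<open>E\<close> is a single unit
  vector, and the formula is read off entry by entry.
\<close>

section \<open>Products with scalar reverse product\<close>

text \<open>
  An eigenvector with non-zero eigenvalue lies in the image of \<open>v \<mapsto> v P E\<close>, hence in the row
  space of \<open>E\<close>; conversely \<open>E (P E) = (E P) E = \<mu> E\<close> makes every row of \<open>E\<close> an eigenvector.
  In particular \<open>\<mu>\<close> is the only non-zero eigenvalue, so the union is a subspace.
\<close>
lemma left_eigenspaces_of_product:
  fixes E :: "'a::field^'n^'m" and P :: "'a^'m^'n"
  assumes "E ** P = mat \<mu>" and "\<mu> \<noteq> 0"
  shows "(\<Union>c\<in>-{0}. left_eigenspace (P ** E) c) = vec.span (rows E)"
proof
  show "(\<Union>c\<in>-{0}. left_eigenspace (P ** E) c) \<subseteq> vec.span (rows E)"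
  proof
    fix v assume "v \<in> (\<Union>c\<in>-{0}. left_eigenspace (P ** E) c)"
    then obtain c where "c \<noteq> 0" and "v v* (P ** E) = c *s v"
      by (auto simp: left_eigenspace_def)
    then have "v = inverse c *s ((v v* P) v* E)"
      by (simp add: vector_matrix_mul_assoc)
    also have "\<dots> \<in> vec.span (rows E)"
    proof -
      have "w v* E = (\<Sum>i\<in>UNIV. w $ i *s row i E)" for w
        using matrix_mult_sum[of "transpose E" w] by simp
      then show ?thesis
        by (auto intro!: vec.span_scale vec.span_sum vec.span_base[of "row _ E"] simp: rows_def)
    qed
    finally show "v \<in> vec.span (rows E)" .
  qed
  have "row i E \<in> left_eigenspace (P ** E) \<mu>" for i
  proof -
    have row: "row i A = axis i 1 v* A" for A :: "'a^'n^'m"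
      by (simp add: row_def vector_matrix_mult_def axis_def vec_eq_iff if_distrib[of "\<lambda>x. _ * x"]
          if_distrib[of "\<lambda>x. x * _"] cong: if_cong)
    have "row i E v* (P ** E) = (axis i 1 v* (E ** P)) v* E"
      by (simp add: row vector_matrix_mul_assoc matrix_mul_assoc)
    also have "axis i 1 v* (E ** P) = \<mu> *s axis i 1"
      unfolding assms(1)
      by (auto simp: vector_matrix_mult_def mat_def axis_def vec_eq_iff if_distrib[of "\<lambda>x. _ * x"]
          if_distrib[of "\<lambda>x. x * _"] cong: if_cong)
    finally show ?thesis
      by (simp add: left_eigenspace_def row scalar_vector_matrix_assoc)
  qed
  moreover have "vec.subspace (left_eigenspace (P ** E) \<mu>)"
    by (auto simp: vec.subspace_def left_eigenspace_def vector_matrix_left_distrib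
        vec.scale_right_distrib scalar_vector_matrix_assoc mult.commute)
  ultimately have "vec.span (rows E) \<subseteq> left_eigenspace (P ** E) \<mu>"
    by (intro vec.span_minimal) (auto simp: rows_def)
  then show "vec.span (rows E) \<subseteq> (\<Union>c\<in>-{0}. left_eigenspace (P ** E) c)"
    using \<open>\<mu> \<noteq> 0\<close> by blast
qed

text \<open>
  The second hypothesis is what self-adjointness of \<open>P E\<close> with respect to \<open>C\<close> says on
  the rows of \<open>E\<close> when these are left eigenvectors for \<open>\<mu>\<close>; inverting the Gram matrix solves it
  for \<open>P\<close>.
\<close>
lemma product_from_gram_matrix:
  fixes E :: "'a::field^'n^'m" and P :: "'a^'m^'n"
  assumes "invertible (E ** C ** transpose E)"
    and "P ** (E ** C ** transpose E) = \<mu> *\<^sub>M (C ** transpose E)"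
  shows "P ** E = \<mu> *\<^sub>M (C ** transpose E ** matrix_inv (E ** C ** transpose E) ** E)"
proof -
  let ?G = "E ** C ** transpose E"
  have scale: "(\<mu> *\<^sub>M A) ** B = \<mu> *\<^sub>M (A ** B)" for A :: "'a^'k^'n" and B :: "'a^'l^'k"
    by (simp add: mat_scale_def matrix_matrix_mult_def vec_eq_iff sum_distrib_left mult.assoc)
  have "?G ** matrix_inv ?G = mat 1"
    using assms(1) unfolding invertible_def matrix_inv_def by (metis (mono_tags, lifting) someI_ex)
  then have "P = P ** ?G ** matrix_inv ?G"
    by (simp add: matrix_mul_assoc[symmetric])
  then show ?thesis
    by (metis assms(2) scale)
qed

section \<open>Intersection numbers of the eigenvectors\<close>

text \<open>
  These are all the forms that occur as denominators, as factors of the determinants of the Gram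
  matrices, or as eigenvalues. Characteristic zero enters the computations only through \<open>2 \<noteq> 0\<close>.
\<close>
lemma nonzero_forms:
  "(2::ratfun4) \<noteq> 0" "l1 \<noteq> 0" "l2 \<noteq> 0" "l3 \<noteq> 0" "l4 \<noteq> 0" "l0 \<noteq> 0" "l123 \<noteq> 0"
  "l134m \<noteq> 0" "l234m \<noteq> 0" "l1 + l3 \<noteq> 0" "l2 + l3 \<noteq> 0" "l3 + l4 \<noteq> 0"
proof -
  have two: "(2::ratfun4) = to_fract (1 + 1)"
    by (subst to_fract_add) simp
  show "(2::ratfun4) \<noteq> 0"
    unfolding two to_fract_eq_0_iff by simp
  show "l1 \<noteq> 0" "l2 \<noteq> 0" "l3 \<noteq> 0" "l4 \<noteq> 0" "l0 \<noteq> 0" "l123 \<noteq> 0"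
    "l134m \<noteq> 0" "l234m \<noteq> 0" "l1 + l3 \<noteq> 0" "l2 + l3 \<noteq> 0" "l3 + l4 \<noteq> 0"
    unfolding l0_def l123_def l134m_def l234m_def l1_def l2_def l3_def l4_def mult_2
    by (simp_all only: to_fract_add[symmetric] to_fract_uminus[symmetric] to_fract_eq_0_iff)
       simp_all
qed

lemmas matrix_entries = vec_eq_iff forall_2 forall_4 sum_2 sum_4 matrix_matrix_mult_def
  transpose_def vector_2 vector_4_nth mat_def mat_scale_def

lemmas linear_forms = l0_def l123_def l134m_def l234m_def

text \<open>
  The common factor of the entries of \<open>C e\<^sub>5\<^sup>T\<close> and thus of all intersection numbers with \<open>e\<^sub>5\<close>.
\<close>
definition e5_scale :: ratfun4 where "e5_scale = - 2 / (l0 * l3 * l4)"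

text \<open>
  In each of the first three rows the poles along \<open>l123\<close>, \<open>l134m\<close> and \<open>l234m\<close> cancel, and only
  the denominators of the common factor survive. This vector gives the second column of both
  \<open>4 \<times> 2\<close> matrices \<open>C E\<^sup>T\<close> and, up to the pairing of \<open>e2\<close> or \<open>e3\<close> with itself, both Gram matrices.
\<close>
lemma hatC_e5:
  "hatC *v e5 = e5_scale *s vector [l4, l1 + l3, l2 + l3, - l0]"
proof -
  have 1: "c11 * (l123 / l3) + c12 * ((l2 - l4) / l3) + c13 * ((l1 - l4) / l3)
      = e5_scale * l4"
    unfolding c11_def c12_def c13_def e5_scale_def using nonzero_forms
    by (simp add: divide_simps) (simp add: linear_forms algebra_simps)
  have 2: "c12 * (l123 / l3) + c22 * ((l2 - l4) / l3) + c23 * ((l1 - l4) / l3)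
      = e5_scale * (l1 + l3)"
    unfolding c12_def c22_def c23_def e5_scale_def using nonzero_forms
    by (simp add: divide_simps) (simp add: linear_forms algebra_simps)
  have 3: "c13 * (l123 / l3) + c23 * ((l2 - l4) / l3) + c33 * ((l1 - l4) / l3)
      = e5_scale * (l2 + l3)"
    unfolding c13_def c23_def c33_def e5_scale_def using nonzero_forms
    by (simp add: divide_simps) (simp add: linear_forms algebra_simps)
  have 4: "c44 = e5_scale * (- l0)"
    using nonzero_forms by (simp add: c44_def e5_scale_def)
  show ?thesis
    unfolding hatC_def e5_def vec_eq_iff forall_4
    by (simp only: matrix_vector_mult_def vec_lambda_beta sum_4 vector_4_nth vector_smult_component
        1 2 3 4 mult_zero_left mult_zero_right mult_1_right add_0_left add_0_right)
qed

lemma mult_transpose_two_rows: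
  fixes C :: "'a::comm_semiring_1^'n^'m"
  shows "(C ** transpose (vector [v, w] :: 'a^'n^2)) $ i = vector [(C *v v) $ i, (C *v w) $ i]"
  by (simp add: vec_eq_iff forall_2 vector_2 matrix_matrix_mult_def matrix_vector_mult_def
      transpose_def)

lemma rows_two_rows: "rows (vector [v, w] :: 'a::zero^'n^2) = {v, w}"
proof -
  have "rows (vector [v, w] :: 'a^'n^2) = (\<lambda>i. row i (vector [v, w])) ` {1, 2 :: 2}"
    unfolding UNIV_2[symmetric] by (auto simp: rows_def)
  then show ?thesis
    by (simp add: row_def vector_2)
qed

lemma hatC_E25: "hatC ** transpose E25 = vector [
    vector [c12, e5_scale * l4],
    vector [c22, e5_scale * (l1 + l3)],
    vector [c23, e5_scale * (l2 + l3)],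
    vector [0, e5_scale * (- l0)]]"
proof -
  have "hatC *v e2 = vector [c12, c22, c23, 0]"
    by (simp add: hatC_def e2_def matrix_vector_mult_def vec_eq_iff forall_4 sum_4 vector_4_nth)
  then show ?thesis
    unfolding E25_def vec_eq_iff[of "hatC ** _"] forall_4
    by (simp only: mult_transpose_two_rows hatC_e5 vector_smult_component vector_4_nth simp_thms)
qed

lemma hatC_E35: "hatC ** transpose E35 = vector [
    vector [c13, e5_scale * l4],
    vector [c23, e5_scale * (l1 + l3)],
    vector [c33, e5_scale * (l2 + l3)],
    vector [0, e5_scale * (- l0)]]"
proof -
  have "hatC *v e3 = vector [c13, c23, c33, 0]"
    by (simp add: hatC_def e3_def matrix_vector_mult_def vec_eq_iff forall_4 sum_4 vector_4_nth)
  then show ?thesis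
    unfolding E35_def vec_eq_iff[of "hatC ** _"] forall_4
    by (simp only: mult_transpose_two_rows hatC_e5 vector_smult_component vector_4_nth simp_thms)
qed

text \<open>
  The self-pairing of \<open>e2\<close>. The factor \<open>l1 + l3\<close> is the negative of the eigenvalue of \<open>e2\<close>; it
  has to be visible here, since it is common to all entries of \<open>hatC1\<close> and gives the square in
  the determinant.
\<close>
lemma c22_factored: "c22 = (l3 - l134m) * (l1 + l3) / (l0 * l2 * l4 * l134m)"
  unfolding c22_def using nonzero_forms
  by (simp add: divide_simps) (simp add: linear_forms algebra_simps)

lemma c33_factored: "c33 = (l3 - l234m) * (l2 + l3) / (l0 * l1 * l4 * l234m)"
  unfolding c33_def using nonzero_forms
  by (simp add: divide_simps) (simp add: linear_forms algebra_simps)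

lemma e5_self_pairing:
  "l123 / l3 * (e5_scale * l4) + (l2 - l4) / l3 * (e5_scale * (l1 + l3))
     + (l1 - l4) / l3 * (e5_scale * (l2 + l3)) + e5_scale * (- l0)
   = 2 * e5_scale * (l1 + l3) * (l2 + l3) / l3"
  using nonzero_forms
  by (simp add: divide_simps) (simp add: linear_forms algebra_simps)

lemma hatC1_entries: "hatC1 = vector [
    vector [c22, e5_scale * (l1 + l3)],
    vector [e5_scale * (l1 + l3), 2 * e5_scale * (l1 + l3) * (l2 + l3) / l3]]"
proof -
  have "l123 / l3 * c12 + (l2 - l4) / l3 * c22 + (l1 - l4) / l3 * c23
      = e5_scale * (l1 + l3)"
    unfolding c12_def c22_def c23_def e5_scale_def using nonzero_forms
    by (simp add: divide_simps) (simp add: linear_forms algebra_simps)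
  then show ?thesis
    unfolding hatC1_def matrix_mul_assoc[symmetric] hatC_E25
    unfolding E25_def e2_def e5_def vec_eq_iff forall_2 forall_4
    by (simp only: matrix_matrix_mult_def vec_lambda_beta sum_4 vector_2 vector_4_nth
        e5_self_pairing mult_zero_left mult_zero_right mult_1_left add_0_left add_0_right simp_thms)
qed

lemma hatC2_entries: "hatC2 = vector [
    vector [c33, e5_scale * (l2 + l3)],
    vector [e5_scale * (l2 + l3), 2 * e5_scale * (l1 + l3) * (l2 + l3) / l3]]"
proof -
  have "l123 / l3 * c13 + (l2 - l4) / l3 * c23 + (l1 - l4) / l3 * c33
      = e5_scale * (l2 + l3)"
    unfolding c13_def c23_def c33_def e5_scale_def using nonzero_forms
    by (simp add: divide_simps) (simp add: linear_forms algebra_simps)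
  then show ?thesis
    unfolding hatC2_def matrix_mul_assoc[symmetric] hatC_E35
    unfolding E35_def e3_def e5_def vec_eq_iff forall_2 forall_4
    by (simp only: matrix_matrix_mult_def vec_lambda_beta sum_4 vector_2 vector_4_nth
        e5_self_pairing mult_zero_left mult_zero_right mult_1_left add_0_left add_0_right simp_thms)
qed

text \<open>
  After the common factors are taken out, what remains of the \<open>2 \<times> 2\<close> determinant is
  \<open>(l3 - l134m) (l2 + l3) + l2 l134m = l3 (l3 - l134m + l2) = - l0 l3\<close>,
  which cancels against the same factors of the denominator.
\<close>
lemma det_hatC1: "det hatC1 = (2 * (l1 + l3) / l4)\<^sup>2 / (l0 * l2 * l3 * l134m)"
  unfolding hatC1_entries det_2 vector_2 c22_factored e5_scale_def
  using nonzero_forms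
  by (simp add: divide_simps power2_eq_square) (simp add: linear_forms algebra_simps)

lemma det_hatC2: "det hatC2 = (2 * (l2 + l3) / l4)\<^sup>2 / (l0 * l1 * l3 * l234m)"
  unfolding hatC2_entries det_2 vector_2 c33_factored e5_scale_def
  using nonzero_forms
  by (simp add: divide_simps power2_eq_square) (simp add: linear_forms algebra_simps)

section \<open>The factorization of the connection matrices\<close>

text \<open>
  The coordinates of the rows of \<open>hatXi1\<close> in terms of \<open>e2\<close> and \<open>e5\<close>. As \<open>e5\<close> ends in 1 and
  \<open>e2\<close> in 0, the coefficient of \<open>e5\<close> is the last entry of the row; subtracting that multiple of
  \<open>e5\<close> leaves the second entry as coefficient of \<open>e2\<close>.
\<close>
definition Xi1_coords :: "ratfun4^2^4" where
  "Xi1_coords = vector [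
    vector [- l4, 0],
    vector [- (l1 + l3), 0],
    vector [0, - l3 / 2],
    vector [- l2 * l134m / l3, (l134m - l3) / 2]]"

definition Xi2_coords :: "ratfun4^2^4" where
  "Xi2_coords = vector [
    vector [- l4, 0],
    vector [0, - l3 / 2],
    vector [- (l2 + l3), 0],
    vector [- l1 * l234m / l3, (l234m - l3) / 2]]"

lemma hatXi1_eq: "hatXi1 = Xi1_coords ** E25"
  unfolding hatXi1_def Xi1_coords_def E25_def e2_def e5_def using nonzero_forms
  by (simp add: matrix_entries divide_simps) (simp add: linear_forms algebra_simps)

lemma hatXi2_eq: "hatXi2 = Xi2_coords ** E35"
  unfolding hatXi2_def Xi2_coords_def E35_def e3_def e5_def using nonzero_forms
  by (simp add: matrix_entries divide_simps) (simp add: linear_forms algebra_simps)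

lemma E25_Xi1_coords: "E25 ** Xi1_coords = mat (- (l1 + l3))"
  unfolding Xi1_coords_def E25_def e2_def e5_def using nonzero_forms
  by (simp add: matrix_entries divide_simps) (simp add: linear_forms algebra_simps)

lemma E35_Xi2_coords: "E35 ** Xi2_coords = mat (- (l2 + l3))"
  unfolding Xi2_coords_def E35_def e3_def e5_def using nonzero_forms
  by (simp add: matrix_entries divide_simps) (simp add: linear_forms algebra_simps)

text \<open>
  The self-adjointness of \<open>hatXi1\<close> with respect to \<open>hatC\<close>, tested on the eigenvectors \<open>e2\<close> and
  \<open>e5\<close> in the two columns.
\<close>
lemma Xi1_coords_hatC1: "Xi1_coords ** hatC1 = (- (l1 + l3)) *\<^sub>M (hatC ** transpose E25)"
  unfolding Xi1_coords_def hatC1_entries hatC_E25 c22_factored c12_def c23_def e5_scale_def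
  using nonzero_forms
  by (simp add: matrix_entries divide_simps) (simp add: linear_forms algebra_simps)

lemma Xi2_coords_hatC2: "Xi2_coords ** hatC2 = (- (l2 + l3)) *\<^sub>M (hatC ** transpose E35)"
  unfolding Xi2_coords_def hatC2_entries hatC_E35 c33_factored c13_def c23_def e5_scale_def
  using nonzero_forms
  by (simp add: matrix_entries divide_simps) (simp add: linear_forms algebra_simps)

lemma hatXi3_eq:
  "hatXi3 = ((2 * (l3 + l4)) *\<^sub>M columnvector e4 :: ratfun4^1^4) ** (rowvector e4 :: ratfun4^4^1)"
  by (simp add: hatXi3_def e4_def columnvector_def rowvector_def matrix_entries)

theorem lemma5p4:
  shows "(\<Union>c\<in>-{0}. left_eigenspace hatXi1 c) = vec.span {e2, e5}
       \<and> (\<Union>c\<in>-{0}. left_eigenspace hatXi2 c) = vec.span {e3, e5}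
       \<and> (\<Union>c\<in>-{0}. left_eigenspace hatXi3 c) = vec.span {e4}
       \<and> invertible hatC1 \<and> invertible hatC2 \<and> hatC $ 4 $ 4 \<noteq> 0
       \<and> hatXi1 = (- (l1 + l3)) *\<^sub>M (hatC ** transpose E25 ** matrix_inv hatC1 ** E25)
       \<and> hatXi2 = (- (l2 + l3)) *\<^sub>M (hatC ** transpose E35 ** matrix_inv hatC2 ** E35)
       \<and> hatXi3 = (2 * (l3 + l4)) *\<^sub>M
           (hatC ** (columnvector e4 :: ratfun4^1^4)
             ** (inverse (hatC $ 4 $ 4) *\<^sub>M (rowvector e4 :: ratfun4^4^1)))"
proof (intro conjI)
  have nz: "- (l1 + l3) \<noteq> 0" "- (l2 + l3) \<noteq> 0" "2 * (l3 + l4) \<noteq> 0"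
    using nonzero_forms by (simp_all only: neg_equal_0_iff_equal mult_eq_0_iff simp_thms)
  show "(\<Union>c\<in>-{0}. left_eigenspace hatXi1 c) = vec.span {e2, e5}"
    using left_eigenspaces_of_product[OF E25_Xi1_coords nz(1)]
    by (simp add: hatXi1_eq E25_def rows_two_rows)
  show "(\<Union>c\<in>-{0}. left_eigenspace hatXi2 c) = vec.span {e3, e5}"
    using left_eigenspaces_of_product[OF E35_Xi2_coords nz(2)]
    by (simp add: hatXi2_eq E35_def rows_two_rows)
  have "(rowvector e4 :: ratfun4^4^1) ** ((2 * (l3 + l4)) *\<^sub>M columnvector e4) = mat (2 * (l3 + l4))"
    by (simp add: e4_def columnvector_def rowvector_def matrix_entries)
  moreover have "rows (rowvector e4 :: ratfun4^4^1) = {e4}"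
    by (auto simp: rows_def row_def rowvector_def)
  ultimately show "(\<Union>c\<in>-{0}. left_eigenspace hatXi3 c) = vec.span {e4}"
    using left_eigenspaces_of_product[OF _ nz(3)] by (metis hatXi3_eq)
  show inv: "invertible hatC1" "invertible hatC2"
    using nonzero_forms unfolding invertible_det_nz det_hatC1 det_hatC2
    by (simp_all del: distrib_left_numeral)
  show nz44: "hatC $ 4 $ 4 \<noteq> 0"
    using nonzero_forms by (simp add: hatC_def vector_4_nth c44_def)
  show "hatXi1 = (- (l1 + l3)) *\<^sub>M (hatC ** transpose E25 ** matrix_inv hatC1 ** E25)"
    using inv(1) Xi1_coords_hatC1 unfolding hatXi1_eq hatC1_def by (rule product_from_gram_matrix)
  show "hatXi2 = (- (l2 + l3)) *\<^sub>M (hatC ** transpose E35 ** matrix_inv hatC2 ** E35)"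
    using inv(2) Xi2_coords_hatC2 unfolding hatXi2_eq hatC2_def by (rule product_from_gram_matrix)
  show "hatXi3 = (2 * (l3 + l4)) *\<^sub>M
           (hatC ** (columnvector e4 :: ratfun4^1^4)
             ** (inverse (hatC $ 4 $ 4) *\<^sub>M (rowvector e4 :: ratfun4^4^1)))"
    using nz44
    by (simp add: hatXi3_def hatC_def e4_def columnvector_def rowvector_def matrix_entries)
qed

end
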